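(* Let $X$ and $Z$ be infinite-dimensional normed linear spaces over $\mathbb{C}$, let $Y = Z'$ be the dual space of $Z$, also infinite-dimensional, and let $T \in B(X,Y)$. Let $(P_n)_{n\in\mathbb{N}}$ and $(Q_n)_{n\in\mathbb{N}}$ be sequences of operators in $B(X)$ and $B(Y)$ respectively such that $\|P_n\|\,\|Q_n\| \le 1$ for all $n \in \mathbb{N}$. Put $T_n := Q_n T P_n$. If $T_n$ converges to $T$ in the weak$^*$ topology on $B(X,Y)$ as $n \to \infty$, then for each $k \in \mathbb{N}$, $$\lim_{n\to\infty} a_k(T_n) = a_k(T).$$
   Context: For normed linear spaces $X, Y$ over $\mathbb{C}$, $B(X,Y)$ is the space of bounded linear operators from $X$ to $Y$ with the operator norm, $B(X)=B(X,X)$ and $X'=B(X,\mathbb{C})$. For $k\in\mathbb{N}=\{1,2,\dots\}$, $\mathcal{F}_k(X,Y)$ is the set of all finite-rank operators in $B(X,Y)$ of rank less than $k$, and the $k$-th approximation number of $T\in B(X,Y)$ is $a_k(T)=\inf\{\|T-F\| : F\in\mathcal{F}_k(X,Y)\}$. When $Y=Z'$, a sequence (or net) $(T_\alpha)$ in $B(X,Y)$ converges to $T$ in the weak$^*$ topology on $B(X,Y)$ if for each $x\in X$ and $z\in Z$, $|(T_\alpha x)(z)-(Tx)(z)|\to 0$. *)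

theory Defs
  imports "HOL-Analysis.Analysis"
begin

text \<open>The library provides only real normed spaces as a type class. A complex normed space is a
  real one with a compatible complex scalar multiplication; completeness is not assumed.\<close>

class complex_normed_vector = real_normed_vector +
  fixes scaleC :: "complex \<Rightarrow> 'a \<Rightarrow> 'a" (infixr \<open>*\<^sub>C\<close> 75)
  assumes scaleR_scaleC: "r *\<^sub>R x = complex_of_real r *\<^sub>C x"
    and scaleC_add_right: "a *\<^sub>C (x + y) = a *\<^sub>C x + a *\<^sub>C y"
    and scaleC_add_left: "(a + b) *\<^sub>C x = a *\<^sub>C x + b *\<^sub>C x"
    and scaleC_scaleC: "a *\<^sub>C b *\<^sub>C x = (a * b) *\<^sub>C x"
    and scaleC_one: "1 *\<^sub>C x = x"
    and norm_scaleC: "norm (a *\<^sub>C x) = cmod a * norm x"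

global_interpretation cvec: vector_space "scaleC :: complex \<Rightarrow> 'a \<Rightarrow> 'a::complex_normed_vector"
  defines cspan = cvec.span
    and cdim = cvec.dim
  by unfold_locales
    (simp_all add: scaleC_add_right scaleC_add_left scaleC_scaleC scaleC_one)

instantiation complex :: complex_normed_vector
begin

definition scaleC_complex :: "complex \<Rightarrow> complex \<Rightarrow> complex"
  where "scaleC_complex a x = a * x"

instance
  by standard
    (simp_all add: scaleC_complex_def algebra_simps scaleR_conv_of_real norm_mult)

end

definition bounded_clinear ::
    "('a::complex_normed_vector \<Rightarrow> 'b::complex_normed_vector) \<Rightarrow> bool"
  where "bounded_clinear f \<longleftrightarrow> bounded_linear f \<and> (\<forall>c x. f (c *\<^sub>C x) = c *\<^sub>C f x)"

lemma bounded_clinear_linear: "bounded_clinear f \<Longrightarrow> bounded_linear f"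
  by (simp add: bounded_clinear_def)

lemma bounded_clinear_zero: "bounded_clinear (\<lambda>x. 0)"
  by (simp add: bounded_clinear_def)

lemma bounded_clinear_add:
  "bounded_clinear f \<Longrightarrow> bounded_clinear g \<Longrightarrow> bounded_clinear (\<lambda>x. f x + g x)"
  by (simp add: bounded_clinear_def bounded_linear_add scaleC_add_right)

lemma bounded_clinear_minus: "bounded_clinear f \<Longrightarrow> bounded_clinear (\<lambda>x. - f x)"
  by (simp add: bounded_clinear_def bounded_linear_minus)

lemma bounded_clinear_sub:
  "bounded_clinear f \<Longrightarrow> bounded_clinear g \<Longrightarrow> bounded_clinear (\<lambda>x. f x - g x)"
  by (simp add: bounded_clinear_def bounded_linear_sub cvec.scale_right_diff_distrib)

lemma bounded_linear_scaleC: "bounded_linear (\<lambda>x. c *\<^sub>C (x :: 'a::complex_normed_vector))"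
  by (rule bounded_linear_intro[where K = "cmod c"])
    (simp_all add: scaleC_add_right scaleR_scaleC scaleC_scaleC norm_scaleC mult.commute)

lemma bounded_clinear_scaleC: "bounded_clinear f \<Longrightarrow> bounded_clinear (\<lambda>x. c *\<^sub>C f x)"
  by (simp add: bounded_clinear_def bounded_linear_compose[OF bounded_linear_scaleC]
      scaleC_scaleC mult.commute)

lemma bounded_clinear_scaleR: "bounded_clinear f \<Longrightarrow> bounded_clinear (\<lambda>x. r *\<^sub>R f x)"
  by (simp add: scaleR_scaleC bounded_clinear_scaleC)

lemma bounded_clinear_compose:
  "bounded_clinear f \<Longrightarrow> bounded_clinear g \<Longrightarrow> bounded_clinear (\<lambda>x. f (g x))"
  by (simp add: bounded_clinear_def bounded_linear_compose)

typedef (overloaded) ('a, 'b) cblinfun (\<open>(_ \<Rightarrow>\<^sub>C\<^sub>L /_)\<close> [22, 21] 21) =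
  "{f :: 'a::complex_normed_vector \<Rightarrow> 'b::complex_normed_vector. bounded_clinear f}"
  morphisms cblinfun_apply CBlinfun
  using bounded_clinear_zero by blast

declare [[coercion
    "cblinfun_apply :: ('a::complex_normed_vector \<Rightarrow>\<^sub>C\<^sub>L 'b::complex_normed_vector) \<Rightarrow> 'a \<Rightarrow> 'b"]]

setup_lifting type_definition_cblinfun

instantiation cblinfun :: (complex_normed_vector, complex_normed_vector) complex_normed_vector
begin

lift_definition norm_cblinfun :: "'a \<Rightarrow>\<^sub>C\<^sub>L 'b \<Rightarrow> real" is onorm .

lift_definition minus_cblinfun :: "'a \<Rightarrow>\<^sub>C\<^sub>L 'b \<Rightarrow> 'a \<Rightarrow>\<^sub>C\<^sub>L 'b \<Rightarrow> 'a \<Rightarrow>\<^sub>C\<^sub>L 'b"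
  is "\<lambda>f g x. f x - g x"
  by (rule bounded_clinear_sub)

definition dist_cblinfun :: "'a \<Rightarrow>\<^sub>C\<^sub>L 'b \<Rightarrow> 'a \<Rightarrow>\<^sub>C\<^sub>L 'b \<Rightarrow> real"
  where "dist_cblinfun a b = norm (a - b)"

definition uniformity_cblinfun :: "(('a \<Rightarrow>\<^sub>C\<^sub>L 'b) \<times> ('a \<Rightarrow>\<^sub>C\<^sub>L 'b)) filter"
  where [code del]: "uniformity_cblinfun = (INF e\<in>{0 <..}. principal {(x, y). dist x y < e})"

definition open_cblinfun :: "('a \<Rightarrow>\<^sub>C\<^sub>L 'b) set \<Rightarrow> bool"
  where [code del]: "open_cblinfun S = (\<forall>x\<in>S. \<forall>\<^sub>F (x', y) in uniformity. x' = x \<longrightarrow> y \<in> S)"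

lift_definition uminus_cblinfun :: "'a \<Rightarrow>\<^sub>C\<^sub>L 'b \<Rightarrow> 'a \<Rightarrow>\<^sub>C\<^sub>L 'b" is "\<lambda>f x. - f x"
  by (rule bounded_clinear_minus)

lift_definition zero_cblinfun :: "'a \<Rightarrow>\<^sub>C\<^sub>L 'b" is "\<lambda>x. 0"
  by (rule bounded_clinear_zero)

lift_definition plus_cblinfun :: "'a \<Rightarrow>\<^sub>C\<^sub>L 'b \<Rightarrow> 'a \<Rightarrow>\<^sub>C\<^sub>L 'b \<Rightarrow> 'a \<Rightarrow>\<^sub>C\<^sub>L 'b"
  is "\<lambda>f g x. f x + g x"
  by (rule bounded_clinear_add)

lift_definition scaleR_cblinfun :: "real \<Rightarrow> 'a \<Rightarrow>\<^sub>C\<^sub>L 'b \<Rightarrow> 'a \<Rightarrow>\<^sub>C\<^sub>L 'b" is "\<lambda>r f x. r *\<^sub>R f x"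
  by (rule bounded_clinear_scaleR)

lift_definition scaleC_cblinfun :: "complex \<Rightarrow> 'a \<Rightarrow>\<^sub>C\<^sub>L 'b \<Rightarrow> 'a \<Rightarrow>\<^sub>C\<^sub>L 'b" is "\<lambda>c f x. c *\<^sub>C f x"
  by (rule bounded_clinear_scaleC)

definition sgn_cblinfun :: "'a \<Rightarrow>\<^sub>C\<^sub>L 'b \<Rightarrow> 'a \<Rightarrow>\<^sub>C\<^sub>L 'b"
  where "sgn_cblinfun x = scaleR (inverse (norm x)) x"

lemma onorm_scaleC_le:
  assumes "bounded_linear (f :: 'a \<Rightarrow> 'b)"
  shows "onorm (\<lambda>x. c *\<^sub>C f x) \<le> cmod c * onorm f"
proof (rule onorm_bound)
  show "0 \<le> cmod c * onorm f"
    by (simp add: onorm_pos_le assms)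
  show "norm (c *\<^sub>C f x) \<le> cmod c * onorm f * norm x" for x
    using mult_left_mono[OF onorm[OF assms, of x], of "cmod c"]
    by (simp add: norm_scaleC mult.assoc)
qed

lemma onorm_scaleC:
  assumes f: "bounded_linear (f :: 'a \<Rightarrow> 'b)"
  shows "onorm (\<lambda>x. c *\<^sub>C f x) = cmod c * onorm f"
proof (cases "c = 0")
  case True
  then show ?thesis by (simp add: onorm_zero)
next
  case False
  have "onorm (\<lambda>x. inverse c *\<^sub>C c *\<^sub>C f x) \<le> cmod (inverse c) * onorm (\<lambda>x. c *\<^sub>C f x)"
    by (rule onorm_scaleC_le) (rule bounded_linear_compose[OF bounded_linear_scaleC f])
  then have "onorm f \<le> inverse (cmod c) * onorm (\<lambda>x. c *\<^sub>C f x)"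
    using False by (simp add: norm_inverse)
  then have "cmod c * onorm f \<le> onorm (\<lambda>x. c *\<^sub>C f x)"
    using False by (simp add: field_simps)
  then show ?thesis
    using onorm_scaleC_le[OF f, of c] by simp
qed

instance
proof
  fix f g h :: "'a \<Rightarrow>\<^sub>C\<^sub>L 'b" and r s :: real and a b :: complex
  show "f + g + h = f + (g + h)" "f + g = g + f" "0 + f = f" "- f + f = 0" "f - g = f + - g"
    by (transfer, simp add: algebra_simps)+
  show "r *\<^sub>R (f + g) = r *\<^sub>R f + r *\<^sub>R g" "(r + s) *\<^sub>R f = r *\<^sub>R f + s *\<^sub>R f"
    "r *\<^sub>R s *\<^sub>R f = (r * s) *\<^sub>R f" "1 *\<^sub>R f = f"
    by (transfer, simp add: algebra_simps)+
  show "dist f g = norm (f - g)"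
    by (simp add: dist_cblinfun_def)
  show "sgn f = inverse (norm f) *\<^sub>R f"
    by (simp add: sgn_cblinfun_def)
  show "uniformity = (INF e\<in>{0<..}. principal {(x, y :: 'a \<Rightarrow>\<^sub>C\<^sub>L 'b). dist x y < e})"
    by (simp add: uniformity_cblinfun_def)
  show "open U = (\<forall>x\<in>U. \<forall>\<^sub>F (x', y) in uniformity. x' = x \<longrightarrow> y \<in> U)"
    for U :: "('a \<Rightarrow>\<^sub>C\<^sub>L 'b) set"
    by (simp add: open_cblinfun_def)
  show "norm f = 0 \<longleftrightarrow> f = 0"
    by transfer (simp add: onorm_eq_0 bounded_clinear_linear fun_eq_iff)
  show "norm (f + g) \<le> norm f + norm g"
    by transfer (simp add: onorm_triangle bounded_clinear_linear)
  show "norm (r *\<^sub>R f) = \<bar>r\<bar> * norm f"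
    by transfer (simp add: onorm_scaleR bounded_clinear_linear)
  show "r *\<^sub>R f = complex_of_real r *\<^sub>C f"
    by transfer (simp add: scaleR_scaleC)
  show "a *\<^sub>C (f + g) = a *\<^sub>C f + a *\<^sub>C g"
    by transfer (simp add: scaleC_add_right)
  show "(a + b) *\<^sub>C f = a *\<^sub>C f + b *\<^sub>C f"
    by transfer (simp add: scaleC_add_left)
  show "a *\<^sub>C b *\<^sub>C f = (a * b) *\<^sub>C f"
    by transfer (simp add: scaleC_scaleC)
  show "1 *\<^sub>C f = f"
    by transfer (simp add: scaleC_one)
  show "norm (a *\<^sub>C f) = cmod a * norm f"
    by transfer (simp add: onorm_scaleC bounded_clinear_linear)
qed

end

lift_definition cblinfun_compose ::
    "('b::complex_normed_vector \<Rightarrow>\<^sub>C\<^sub>L 'c::complex_normed_vector) \<Rightarrow>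
     ('a::complex_normed_vector \<Rightarrow>\<^sub>C\<^sub>L 'b) \<Rightarrow> ('a \<Rightarrow>\<^sub>C\<^sub>L 'c)" (infixl \<open>o\<^sub>C\<^sub>L\<close> 67)
  is "\<lambda>f g x. f (g x)"
  by (rule bounded_clinear_compose)

type_synonym 'z dual = "('z, complex) cblinfun"

text \<open>The following is meant for linear subspaces only. It is needed next to \<^const>\<open>cdim\<close>, which is
  \<open>0\<close> on infinite-dimensional subspaces.\<close>

definition finite_cdim :: "'a::complex_normed_vector set \<Rightarrow> bool"
  where "finite_cdim V \<longleftrightarrow> (\<exists>B. finite B \<and> cspan B = V)"

definition finite_rank_less ::
    "nat \<Rightarrow> ('a::complex_normed_vector \<Rightarrow>\<^sub>C\<^sub>L 'b::complex_normed_vector) set"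
  where "finite_rank_less k =
    {F. finite_cdim (range (cblinfun_apply F)) \<and> cdim (range (cblinfun_apply F)) < k}"

text \<open>For \<open>k = 0\<close> the infimum is over the empty set, and the value is meaningless.\<close>

definition approx_number ::
    "nat \<Rightarrow> ('a::complex_normed_vector \<Rightarrow>\<^sub>C\<^sub>L 'b::complex_normed_vector) \<Rightarrow> real"
  where "approx_number k T = (INF F\<in>finite_rank_less k. norm (T - F))"

definition weak_star_tendsto ::
    "('i \<Rightarrow> ('x::complex_normed_vector \<Rightarrow>\<^sub>C\<^sub>L 'z::complex_normed_vector dual)) \<Rightarrow>
     ('x \<Rightarrow>\<^sub>C\<^sub>L 'z dual) \<Rightarrow> 'i filter \<Rightarrow> bool"
  where "weak_star_tendsto S T \<F> \<longleftrightarrow>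
    (\<forall>x z. ((\<lambda>i. cmod (S i x z - T x z)) \<longlongrightarrow> 0) \<F>)"

end

theory Submission
  imports Defs
begin

text \<open>One inequality is the ideal property \<open>a\<^sub>k (Q T P) \<le> \<parallel>Q\<parallel> a\<^sub>k T \<parallel>P\<parallel>\<close>. For the other, \<open>a\<^sub>k\<close> is lower
  semicontinuous for the weak* topology: if \<open>\<parallel>T\<^sub>n - F\<^sub>n\<parallel> \<le> c\<close> with \<open>F\<^sub>n\<close> of rank less than \<open>k\<close>, then by
  Tychonoff's theorem \<open>T\<^sub>n - F\<^sub>n\<close> has a weak* cluster point \<open>R\<close> with \<open>\<parallel>R\<parallel> \<le> c\<close>, and \<open>T - R\<close> is a weak*
  cluster point of the \<open>F\<^sub>n\<close>. It has rank less than \<open>k\<close>, because this says that all \<open>F x\<^sub>1, \<dots>, F x\<^sub>k\<close>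
  satisfy a relation \<open>\<Sum> c\<^sub>i F x\<^sub>i = 0\<close> with \<open>\<Sum> \<bar>c\<^sub>i\<bar> = 1\<close>, and such coefficients also have a cluster
  point.\<close>

section \<open>Cluster points in products\<close>

text \<open>The closures of the \<open>B i\<close> are compact by Heine-Borel, so by Tychonoff the
  image of \<open>G\<close> under \<open>f\<close> clusters at some \<open>l\<close>. The index type
  may be uncountable, where subsequences would not suffice; the finer filter \<open>G'\<close> plays
  the role of a subnet.\<close>

lemma tychonoff_subfilter:
  fixes f :: "'a \<Rightarrow> 'i \<Rightarrow> 'b::heine_borel"
  assumes "G \<noteq> bot" and "\<And>i. bounded (B i)" and ev: "\<forall>\<^sub>F n in G. \<forall>i. f n i \<in> B i"
  obtains G' l where "G' \<le> G" "G' \<noteq> bot" "\<And>i. ((\<lambda>n. f n i) \<longlongrightarrow> l i) G'"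
proof -
  define K where "K = (PiE UNIV (\<lambda>i. closure (B i)))"
  have "compactin (product_topology (\<lambda>i. euclidean) UNIV) K"
    unfolding K_def compactin_PiE using assms(2) by (simp add: compact_closure)
  then have "compact K"
    by (simp add: euclidean_product_topology)
  moreover have "filtermap f G \<noteq> bot"
    using assms(1) by (simp add: filtermap_bot_iff)
  moreover have "\<forall>\<^sub>F g in filtermap f G. g \<in> K"
    unfolding eventually_filtermap using ev
    by eventually_elim (use closure_subset in \<open>auto simp: K_def\<close>)
  ultimately obtain l where l: "inf (nhds l) (filtermap f G) \<noteq> bot"
    unfolding compact_filter by blast
  \<comment> \<open>The largest filter below \<open>G\<close> along which \<open>f\<close> tends to
    \<open>l\<close>. It is nontrivial because its image lies above the nontrivial filter found for
    \<open>l\<close>.\<close>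
  define G' where "G' = inf G (filtercomap f (nhds l))"
  have "inf (nhds l) (filtermap f G) \<le> filtermap f G'"
    unfolding G'_def le_filter_def eventually_filtermap eventually_inf eventually_filtercomap
  proof safe
    fix P Q R S
    assume PQ: "eventually Q G" "eventually S (nhds l)" "\<forall>x. S (f x) \<longrightarrow> R x"
      "\<forall>x. Q x \<and> R x \<longrightarrow> P (f x)"
    then show "\<exists>Q R. eventually Q (nhds l) \<and> (\<forall>\<^sub>F x in G. R (f x)) \<and> (\<forall>x. Q x \<and> R x \<longrightarrow> P x)"
      \<comment> \<open>The second witness describes the image under \<open>f\<close> of the points
        where \<open>Q\<close> holds.\<close>
      by (intro exI[of _ S] exI[of _ "\<lambda>y. \<exists>x. Q x \<and> y = f x"])
        (auto elim!: eventually_mono)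
  qed
  then have ne: "G' \<noteq> bot"
    using l by (metis filtermap_bot bot.extremum_uniqueI)
  have "((\<lambda>n. f n i) \<longlongrightarrow> l i) G'" for i
  proof -
    have "((\<lambda>g::'i \<Rightarrow> 'b. g i) \<longlongrightarrow> l i) (nhds l)"
    proof (rule topological_tendstoI)
      fix U :: "'b set"
      assume U: "open U" "l i \<in> U"
      have "open ((\<lambda>g::'i \<Rightarrow> 'b. g i) -` U)"
        by (rule open_vimage[OF U(1) continuous_on_product_coordinates])
      then have "\<forall>\<^sub>F g in nhds l. g \<in> (\<lambda>g. g i) -` U"
        by (rule eventually_nhds_in_open) (simp add: U)
      then show "\<forall>\<^sub>F g in nhds l. g i \<in> U"
        by simp
    qed
    moreover have "filterlim f (nhds l) G'"
      unfolding G'_def by (meson filterlim_filtercomap filterlim_mono inf_le2 order_refl)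
    ultimately show ?thesis by (rule filterlim_compose)
  qed
  with ne show thesis
    by (intro that[of G' l]) (auto simp: G'_def)
qed

section \<open>Operators and their norms\<close>

lemma cblinfun_apply_linear:
  "cblinfun_apply F (x + y) = F x + F y"
  "cblinfun_apply F (c *\<^sub>C x) = c *\<^sub>C F x"
  "cblinfun_apply F 0 = 0"
  using cblinfun_apply[of F]
  by (auto simp: bounded_clinear_def linear_simps)

lemma cblinfun_apply_diff: "cblinfun_apply (F - G) x = F x - G x"
  by transfer simp

lemma norm_cblinfun_apply_le: "norm (cblinfun_apply F x) \<le> norm F * norm x"
  by transfer (simp add: onorm bounded_clinear_linear)

lemma norm_cblinfun_leI:
  assumes "0 \<le> c" "\<And>x. norm (cblinfun_apply F x) \<le> c * norm x"
  shows "norm F \<le> c"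
  using assms by transfer (simp add: onorm_bound)

text \<open>Weak* limits first arise as bare functions of \<open>x\<close> and \<open>z\<close>;
  this turns them into operators.\<close>

lemma cblinfun_of_bounded:
  fixes f :: "'a::complex_normed_vector \<Rightarrow> 'b::complex_normed_vector"
  assumes "\<And>x y. f (x + y) = f x + f y" "\<And>c x. f (c *\<^sub>C x) = c *\<^sub>C f x"
    and "\<And>x. norm (f x) \<le> c * norm x"
  obtains F where "\<And>x. cblinfun_apply F x = f x"
proof
  have "bounded_linear f"
    by (rule bounded_linear_intro[where K = c]) (use assms in \<open>auto simp: scaleR_scaleC mult.commute\<close>)
  then show "cblinfun_apply (CBlinfun f) x = f x" for x
    using assms(2) by (simp add: CBlinfun_inverse bounded_clinear_def)
qed

lemma norm_cblinfun_compose_le: "norm (F o\<^sub>C\<^sub>L G) \<le> norm F * norm G"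
proof (rule norm_cblinfun_leI)
  fix x
  have "norm (F (G x)) \<le> norm F * norm (G x)"
    by (rule norm_cblinfun_apply_le)
  also have "\<dots> \<le> norm F * (norm G * norm x)"
    by (intro mult_left_mono norm_cblinfun_apply_le) simp
  finally show "norm ((F o\<^sub>C\<^sub>L G) x) \<le> norm F * norm G * norm x"
    by (simp add: cblinfun_compose.rep_eq mult.assoc)
qed simp

lemma cspan_range_cblinfun: "cspan (range (cblinfun_apply F)) = range F"
proof -
  have "cvec.subspace (range (cblinfun_apply F))"
    unfolding cvec.subspace_def
    by safe (metis cblinfun_apply_linear rangeI)+
  then show ?thesis
    by (simp add: cvec.span_eq_iff)
qed

section \<open>Rank through normalised linear relations\<close>

text \<open>Any nontrivial relation can be rescaled. The normalisation keeps the coefficients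
  bounded and prevents a limit of such relations from becoming trivial.\<close>

lemma cdependent_family:
  fixes y :: "nat \<Rightarrow> 'a::complex_normed_vector"
  assumes "\<not> (inj_on y {..<k} \<and> cvec.independent (y ` {..<k}))"
  shows "\<exists>c. (\<Sum>i<k. cmod (c i)) = 1 \<and> (\<Sum>i<k. c i *\<^sub>C y i) = 0"
proof -
  have "\<exists>u. (\<exists>i<k. u i \<noteq> 0) \<and> (\<Sum>i<k. u i *\<^sub>C y i) = 0"
  proof (cases "inj_on y {..<k}")
    case True
    with assms obtain u where "\<exists>v\<in>y ` {..<k}. u v \<noteq> 0" "(\<Sum>v\<in>y ` {..<k}. u v *\<^sub>C v) = 0"
      by (auto simp: cvec.dependent_finite)
    with True show ?thesis
      by (intro exI[of _ "u \<circ> y"]) (auto simp: sum.reindex)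
  next
    case False
    then obtain i j where ij: "i < k" "j < k" "i \<noteq> j" "y i = y j"
      by (auto simp: inj_on_def)
    \<comment> \<open>A repeated vector gives the relation with coefficients 1 at \<open>i\<close>
      and -1 at \<open>j\<close>.\<close>
    define u :: "nat \<Rightarrow> complex" where "u l = (if l = i then 1 else 0) - (if l = j then 1 else 0)" for l
    have "(\<Sum>l<k. u l *\<^sub>C y l) =
        (\<Sum>l<k. if l = i then y l else 0) - (\<Sum>l<k. if l = j then y l else 0)"
      unfolding sum_subtractf[symmetric] using ij
      by (intro sum.cong) (auto simp: u_def cvec.scale_left_diff_distrib)
    also have "\<dots> = 0"
      using ij by simp
    finally show ?thesis
      using ij by (intro exI[of _ u]) (auto simp: u_def)
  qed
  then obtain u i where u: "i < k" "u i \<noteq> 0" "(\<Sum>i<k. u i *\<^sub>C y i) = 0"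
    by blast
  define s where "s = (\<Sum>i<k. cmod (u i))"
  have s: "s > 0"
    unfolding s_def using u by (intro sum_pos2[of _ i]) auto
  define c where "c l = complex_of_real (inverse s) * u l" for l
  have "cmod (c l) = inverse s * cmod (u l)" for l
    using s by (simp add: c_def norm_mult norm_inverse)
  then have "(\<Sum>l<k. cmod (c l)) = inverse s * s"
    by (simp add: s_def sum_distrib_left)
  moreover have "(\<Sum>l<k. c l *\<^sub>C y l) = complex_of_real (inverse s) *\<^sub>C (\<Sum>l<k. u l *\<^sub>C y l)"
    by (simp add: c_def cvec.scale_sum_right scaleC_scaleC)
  ultimately show ?thesis
    using s u by auto
qed

text \<open>This trades dimension for a condition that survives limits. Any \<open>k\<close> vectors
  in a space of dimension below \<open>k\<close> are dependent; conversely, \<open>k\<close>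
  independent vectors in the range would admit no such relation. For \<open>k = 0\<close> both sides
  fail, the empty sum not being 1.\<close>

lemma finite_rank_less_iff:
  "F \<in> finite_rank_less k \<longleftrightarrow>
    (\<forall>x::nat \<Rightarrow> _. \<exists>c. (\<Sum>i<k. cmod (c i)) = 1 \<and> (\<Sum>i<k. c i *\<^sub>C cblinfun_apply F (x i)) = 0)"
  (is "_ \<longleftrightarrow> ?R")
proof
  assume F: "F \<in> finite_rank_less k"
  obtain B where B: "B \<subseteq> range F" "cvec.independent B" "range F \<subseteq> cspan B" "card B = cdim (range F)"
    using cvec.basis_exists by blast
  obtain A where "finite A" "cspan A = range F"
    using F by (auto simp: finite_rank_less_def finite_cdim_def)
  then have "finite B"
    using cvec.independent_span_bound[of A B] B(1,2) by simp
  show ?R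
  proof (intro allI cdependent_family notI)
    fix x :: "nat \<Rightarrow> _"
    let ?y = "\<lambda>i. cblinfun_apply F (x i)"
    assume y: "inj_on ?y {..<k} \<and> cvec.independent (?y ` {..<k})"
    then have "card (?y ` {..<k}) \<le> card B"
      using B(3) by (intro cvec.independent_span_bound[OF \<open>finite B\<close>, THEN conjunct2]) auto
    with y F B(4) show False
      by (simp add: card_image finite_rank_less_def)
  qed
next
  assume R: ?R
  obtain B where B: "B \<subseteq> range F" "cvec.independent B" "range F \<subseteq> cspan B" "card B = cdim (range F)"
    using cvec.basis_exists by blast
  \<comment> \<open>Finiteness is claimed as well, since \<open>card B = 0\<close> for infinite
    \<open>B\<close>. If either claim fails, \<open>B\<close> has a subset of exactly
    \<open>k\<close> elements.\<close>
  have "finite B \<and> card B < k"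
  proof (rule ccontr)
    assume "\<not> ?thesis"
    then obtain S where S: "S \<subseteq> B" "card S = k" "finite S"
      by (meson infinite_arbitrarily_large linorder_not_less obtain_subset_with_card_n)
    then obtain y where y: "bij_betw y {..<k} S"
      using ex_bij_betw_nat_finite by (metis atLeast0LessThan)
    have "\<forall>i<k. \<exists>x. F x = y i"
      using B(1) S(1) y by (metis bij_betwE f_inv_into_f lessThan_iff subsetD)
    then obtain x where x: "\<And>i. i < k \<Longrightarrow> F (x i) = y i"
      by metis
    obtain c where c: "(\<Sum>i<k. cmod (c i)) = 1" "(\<Sum>i<k. c i *\<^sub>C F (x i)) = 0"
      using R by blast
    \<comment> \<open>Independence takes coefficients indexed by vectors, so \<open>g\<close>
      recovers the index of each vector of \<open>S\<close>.\<close>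
    define g where "g = the_inv_into {..<k} y"
    have g: "g (y i) = i" if "i < k" for i
      using y that by (simp add: g_def the_inv_into_f_f bij_betw_def)
    have "(\<Sum>v\<in>S. c (g v) *\<^sub>C v) = (\<Sum>i<k. c (g (y i)) *\<^sub>C y i)"
      by (rule sum.reindex_bij_betw[OF y, symmetric])
    also have "\<dots> = (\<Sum>i<k. c i *\<^sub>C F (x i))"
      by (intro sum.cong) (auto simp: g x)
    finally have "(\<Sum>v\<in>S. c (g v) *\<^sub>C v) = 0"
      using c by simp
    moreover have "cvec.independent S"
      using B(2) S(1) cvec.independent_mono by blast
    ultimately have "c (g v) = 0" if "v \<in> S" for v
      using cvec.independentD[OF _ S(3) order_refl _ that, of "\<lambda>v. c (g v)"] by blast
    then have "\<forall>i<k. c i = 0"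
      using y g by (metis bij_betwE lessThan_iff)
    with c(1) show False by simp
  qed
  moreover have "cspan B = range F"
    using B(1,3) cspan_range_cblinfun[of F] cvec.span_mono by (metis subset_antisym)
  ultimately show "F \<in> finite_rank_less k"
    using B(4) by (auto simp: finite_rank_less_def finite_cdim_def)
qed

text \<open>A relation for \<open>F\<close> at the points \<open>P (x i)\<close> is carried over by
  \<open>Q\<close> with the same coefficients.\<close>

lemma finite_rank_less_compose:
  assumes "F \<in> finite_rank_less k"
  shows "Q o\<^sub>C\<^sub>L F o\<^sub>C\<^sub>L P \<in> finite_rank_less k"
  unfolding finite_rank_less_iff
proof
  fix x :: "nat \<Rightarrow> _"
  obtain c where c: "(\<Sum>i<k. cmod (c i)) = 1" "(\<Sum>i<k. c i *\<^sub>C F (P (x i))) = 0"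
    using assms[unfolded finite_rank_less_iff, rule_format, of "\<lambda>i. P (x i)"] by blast
  have "(\<Sum>i<k. c i *\<^sub>C Q (F (P (x i)))) = Q (\<Sum>i<k. c i *\<^sub>C F (P (x i)))"
    by (induction k) (simp_all add: cblinfun_apply_linear)
  with c show "\<exists>c. (\<Sum>i<k. cmod (c i)) = 1 \<and> (\<Sum>i<k. c i *\<^sub>C (Q o\<^sub>C\<^sub>L F o\<^sub>C\<^sub>L P) (x i)) = 0"
    by (auto simp: cblinfun_compose.rep_eq cblinfun_apply_linear)
qed

section \<open>Weak* compactness and closedness\<close>

lemma weak_star_tendsto_iff:
  "weak_star_tendsto S T G \<longleftrightarrow> (\<forall>x z. ((\<lambda>i. S i x z) \<longlongrightarrow> T x z) G)"
  by (simp add: weak_star_tendsto_def tendsto_norm_zero_iff LIM_zero_iff)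

text \<open>Banach-Alaoglu for operators into a dual: Tychonoff is applied to the values at all
  pairs \<open>(x, z)\<close>, and the bilinear limit form defines an operator with the same
  bound.\<close>

lemma weak_star_cluster_point:
  fixes S :: "'i \<Rightarrow> ('x::complex_normed_vector \<Rightarrow>\<^sub>C\<^sub>L 'z::complex_normed_vector dual)"
  assumes "G \<noteq> bot" and "\<forall>\<^sub>F i in G. norm (S i) \<le> c"
  obtains G' R where "G' \<le> G" "G' \<noteq> bot" "weak_star_tendsto S R G'" "norm R \<le> c"
proof -
  define B where "B p = cball (0::complex) (c * norm (fst p) * norm (snd p))" for p :: "'x \<times> 'z"
  have le: "cmod (S i x z) \<le> c * norm x * norm z" if "norm (S i) \<le> c" for i x z
  proof -
    have "cmod (S i x z) \<le> norm (S i x) * norm z"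
      by (rule norm_cblinfun_apply_le)
    also have "norm (S i x) \<le> norm (S i) * norm x"
      by (rule norm_cblinfun_apply_le)
    also have "norm (S i) \<le> c"
      by (rule that)
    finally show ?thesis
      by (simp add: mult_right_mono)
  qed
  have "\<forall>\<^sub>F i in G. \<forall>p. S i (fst p) (snd p) \<in> B p"
    using assms(2) by eventually_elim (auto simp: B_def le)
  moreover have "\<And>p. bounded (B p)"
    by (simp add: B_def)
  ultimately obtain G' l where G': "G' \<le> G" "G' \<noteq> bot"
      and l: "\<And>p. ((\<lambda>i. S i (fst p) (snd p)) \<longlongrightarrow> l p) G'"
    using tychonoff_subfilter[OF assms(1), of B "\<lambda>i p. S i (fst p) (snd p)"] by blast
  have lim: "((\<lambda>i. S i x z) \<longlongrightarrow> l (x, z)) G'" for x z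
    using l[of "(x, z)"] by simp
  note unique = tendsto_unique[OF G'(2)]
  have ev: "\<forall>\<^sub>F i in G'. norm (S i) \<le> c"
    using assms(2) G'(1) by (rule filter_leD[rotated])
  \<comment> \<open>Nontriviality of \<open>G'\<close> provides some \<open>i\<close> with
    \<open>norm (S i) \<le> c\<close>.\<close>
  have "0 \<le> c"
    using eventually_happens[OF ev] G'(2) norm_ge_zero order_trans by blast
  have l_le: "cmod (l (x, z)) \<le> c * norm x * norm z" for x z
    by (rule tendsto_upperbound[OF tendsto_norm[OF lim] _ G'(2)])
      (use ev in eventually_elim, simp add: le)
  \<comment> \<open>Uniqueness of limits gives linearity in \<open>z\<close> for fixed
    \<open>x\<close>, hence a functional; the same argument in \<open>x\<close> then assembles these
    functionals into \<open>R\<close>.\<close>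
  have "\<exists>f. \<forall>z. cblinfun_apply f z = l (x, z)" for x
  proof -
    have "l (x, z + w) = l (x, z) + l (x, w)" for z w
      using unique[OF lim] tendsto_add[OF lim[of x z] lim[of x w]] by (simp add: cblinfun_apply_linear)
    moreover have "l (x, a *\<^sub>C z) = a *\<^sub>C l (x, z)" for a z
      using unique[OF lim] tendsto_mult_left[OF lim[of x z], of a]
      by (simp add: cblinfun_apply_linear scaleC_complex_def)
    ultimately show ?thesis
      using cblinfun_of_bounded[of "\<lambda>z. l (x, z)" "c * norm x"] l_le by metis
  qed
  then obtain r :: "'x \<Rightarrow> 'z dual" where r: "\<And>x z. r x z = l (x, z)"
    by metis
  have r_le: "norm (r x) \<le> c * norm x" for x
    using l_le \<open>0 \<le> c\<close> by (intro norm_cblinfun_leI) (auto simp: r)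
  have "r (x + y) = r x + r y" for x y
  proof (intro cblinfun_apply_inject[THEN iffD1] ext)
    show "r (x + y) z = (r x + r y) z" for z
      using unique[OF lim] tendsto_add[OF lim[of x z] lim[of y z]]
      by (simp add: cblinfun_apply_linear plus_cblinfun.rep_eq r)
  qed
  moreover have "r (a *\<^sub>C x) = a *\<^sub>C r x" for a x
  proof (intro cblinfun_apply_inject[THEN iffD1] ext)
    show "r (a *\<^sub>C x) z = (a *\<^sub>C r x) z" for z
      using unique[OF lim] tendsto_mult_left[OF lim[of x z], of a]
      by (simp add: cblinfun_apply_linear scaleC_cblinfun.rep_eq scaleC_complex_def r)
  qed
  ultimately obtain R where R: "\<And>x. cblinfun_apply R x = r x"
    using cblinfun_of_bounded r_le by metis
  show thesis
  proof (rule that[OF G'])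
    show "weak_star_tendsto S R G'"
      by (simp add: weak_star_tendsto_iff R r lim)
    show "norm R \<le> c"
      by (rule norm_cblinfun_leI[OF \<open>0 \<le> c\<close>]) (simp add: R r_le)
  qed
qed

text \<open>For fixed points \<open>x j\<close>, normalised relations satisfied by the
  \<open>S i\<close> have coefficients in the unit disc. Along a subfilter these converge, and both
  the normalisation and the relation, tested at each \<open>z\<close>, pass to the limit.\<close>

lemma finite_rank_less_weak_star_closed:
  fixes S :: "'i \<Rightarrow> ('x::complex_normed_vector \<Rightarrow>\<^sub>C\<^sub>L 'z::complex_normed_vector dual)"
  assumes "G \<noteq> bot" and ev: "\<forall>\<^sub>F i in G. S i \<in> finite_rank_less k"
    and "weak_star_tendsto S F G"
  shows "F \<in> finite_rank_less k"
  unfolding finite_rank_less_iff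
proof
  fix x :: "nat \<Rightarrow> 'x"
  define C where "C i c \<longleftrightarrow> (\<Sum>j<k. cmod (c j)) = 1 \<and> (\<Sum>j<k. c j *\<^sub>C S i (x j)) = 0"
    for i and c :: "nat \<Rightarrow> complex"
  have "\<forall>i. \<exists>c. S i \<in> finite_rank_less k \<longrightarrow> C i c"
    by (auto simp: finite_rank_less_iff C_def)
  then obtain c0 where c0: "\<And>i. S i \<in> finite_rank_less k \<Longrightarrow> C i (c0 i)"
    by metis
  \<comment> \<open>Setting the coefficients beyond \<open>k\<close> to 0 bounds every coordinate,
    as \<open>tychonoff_subfilter\<close> demands.\<close>
  define c where "c i j = (if j < k then c0 i j else 0)" for i j
  have c: "C i (c i)" if "S i \<in> finite_rank_less k" for i
    using c0[OF that] by (simp add: C_def c_def)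
  have "\<forall>\<^sub>F i in G. \<forall>j. c i j \<in> cball 0 1"
    using ev
  proof eventually_elim
    case (elim i)
    have "cmod (c i j) \<le> 1" if "j < k" for j
      using member_le_sum[of j "{..<k}" "\<lambda>j. cmod (c i j)"] c[OF elim] that by (simp add: C_def)
    then show ?case
      by (auto simp: c_def)
  qed
  then obtain G' d where G': "G' \<le> G" "G' \<noteq> bot" and d: "\<And>j. ((\<lambda>i. c i j) \<longlongrightarrow> d j) G'"
    using tychonoff_subfilter[OF assms(1), of "\<lambda>_. cball 0 1" c] by auto
  have evC: "\<forall>\<^sub>F i in G'. C i (c i)"
    using filter_leD[OF G'(1) ev] by eventually_elim (rule c)
  have "((\<lambda>i. \<Sum>j<k. cmod (c i j)) \<longlongrightarrow> (\<Sum>j<k. cmod (d j))) G'"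
    by (intro tendsto_intros d)
  moreover have "((\<lambda>i. \<Sum>j<k. cmod (c i j)) \<longlongrightarrow> 1) G'"
    by (rule tendsto_eventually) (use evC in eventually_elim, simp add: C_def)
  ultimately have "(\<Sum>j<k. cmod (d j)) = 1"
    using tendsto_unique[OF G'(2)] by blast
  moreover have "(\<Sum>j<k. d j *\<^sub>C F (x j)) = 0"
  proof (intro cblinfun_apply_inject[THEN iffD1] ext)
    fix z
    \<comment> \<open>Evaluation at \<open>z\<close> reduces the relation to a finite sum of
      products of convergent complex numbers.\<close>
    have expand: "cblinfun_apply (\<Sum>j<k. a j *\<^sub>C U (x j)) z = (\<Sum>j<k. a j * U (x j) z)"
      for a and U :: "'x \<Rightarrow>\<^sub>C\<^sub>L 'z dual"
      by (induction k)
        (simp_all add: zero_cblinfun.rep_eq plus_cblinfun.rep_eq scaleC_cblinfun.rep_eq scaleC_complex_def)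
    have "((\<lambda>i. S i (x j) z) \<longlongrightarrow> F (x j) z) G'" for j
      using assms(3) G'(1) by (auto simp: weak_star_tendsto_iff intro: tendsto_mono)
    then have "((\<lambda>i. \<Sum>j<k. c i j * S i (x j) z) \<longlongrightarrow> (\<Sum>j<k. d j * F (x j) z)) G'"
      by (intro tendsto_intros d)
    moreover have "((\<lambda>i. \<Sum>j<k. c i j * S i (x j) z) \<longlongrightarrow> 0) G'"
      by (rule tendsto_eventually)
        (use evC in eventually_elim, simp add: C_def expand[symmetric] zero_cblinfun.rep_eq)
    ultimately show "cblinfun_apply (\<Sum>j<k. d j *\<^sub>C F (x j)) z = cblinfun_apply 0 z"
      using tendsto_unique[OF G'(2)] by (simp add: expand zero_cblinfun.rep_eq)
  qed
  ultimately show "\<exists>c. (\<Sum>i<k. cmod (c i)) = 1 \<and> (\<Sum>i<k. c i *\<^sub>C F (x i)) = 0"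
    by blast
qed

section \<open>Approximation numbers\<close>

text \<open>Ensures that the infimum in \<open>approx_number\<close> is over a nonempty set.\<close>

lemma zero_in_finite_rank_less:
  assumes "k \<ge> 1"
  shows "0 \<in> finite_rank_less k"
  unfolding finite_rank_less_iff
proof
  fix x :: "nat \<Rightarrow> 'a"
  define c :: "nat \<Rightarrow> complex" where "c i = of_bool (i = 0)" for i
  have "(\<Sum>i<k. cmod (c i)) = (\<Sum>i<k. if i = 0 then 1 else 0)"
    by (rule sum.cong) (auto simp: c_def)
  also have "\<dots> = 1"
    using assms by simp
  finally show "\<exists>c. (\<Sum>i<k. cmod (c i)) = 1 \<and>
      (\<Sum>i<k. c i *\<^sub>C cblinfun_apply (0 :: 'a \<Rightarrow>\<^sub>C\<^sub>L 'b) (x i)) = 0"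
    by (intro exI[of _ c]) (simp add: zero_cblinfun.rep_eq)
qed

lemma approx_number_bdd_below: "bdd_below ((\<lambda>F. norm (T - F)) ` finite_rank_less k)"
  by (rule bdd_belowI2[of _ 0]) simp

lemma approx_number_le: "F \<in> finite_rank_less k \<Longrightarrow> approx_number k T \<le> norm (T - F)"
  unfolding approx_number_def by (rule cINF_lower[OF approx_number_bdd_below])

text \<open>The strict inequality produces an actual \<open>F\<close> without asking whether the
  infimum is attained.\<close>

lemma approx_number_less_iff:
  fixes T :: "'a::complex_normed_vector \<Rightarrow>\<^sub>C\<^sub>L 'b::complex_normed_vector"
  assumes "k \<ge> 1"
  shows "approx_number k T < c \<longleftrightarrow> (\<exists>F\<in>finite_rank_less k. norm (T - F) < c)"
  unfolding approx_number_def
proof (rule cINF_less_iff)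
  show "finite_rank_less k \<noteq> ({} :: ('a \<Rightarrow>\<^sub>C\<^sub>L 'b) set)"
    using zero_in_finite_rank_less[OF assms] by blast
qed (rule approx_number_bdd_below)

text \<open>If \<open>F\<close> approximates \<open>T\<close>, then \<open>Q F P\<close>
  approximates \<open>Q T P\<close> with error \<open>Q (T - F) P\<close>, whose norm is at most
  that of \<open>T - F\<close>.\<close>

lemma approx_number_compose_le:
  assumes "k \<ge> 1" "norm P * norm Q \<le> 1"
  shows "approx_number k (Q o\<^sub>C\<^sub>L T o\<^sub>C\<^sub>L P) \<le> approx_number k T"
proof (rule ccontr)
  assume "\<not> ?thesis"
  then obtain F where F: "F \<in> finite_rank_less k"
      "norm (T - F) < approx_number k (Q o\<^sub>C\<^sub>L T o\<^sub>C\<^sub>L P)"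
    using approx_number_less_iff[OF assms(1)] by (auto simp: not_le)
  have "cblinfun_apply Q (a - b) = Q a - Q b" for a b
    using cblinfun_apply[of Q] by (auto simp: bounded_clinear_def linear_simps)
  then have "(Q o\<^sub>C\<^sub>L T o\<^sub>C\<^sub>L P) - (Q o\<^sub>C\<^sub>L F o\<^sub>C\<^sub>L P) = Q o\<^sub>C\<^sub>L (T - F) o\<^sub>C\<^sub>L P"
    by (intro cblinfun_apply_inject[THEN iffD1] ext)
      (simp add: cblinfun_apply_diff cblinfun_compose.rep_eq)
  then have "approx_number k (Q o\<^sub>C\<^sub>L T o\<^sub>C\<^sub>L P) \<le> norm (Q o\<^sub>C\<^sub>L (T - F) o\<^sub>C\<^sub>L P)"
    using approx_number_le[OF finite_rank_less_compose[OF F(1), of Q P], of "Q o\<^sub>C\<^sub>L T o\<^sub>C\<^sub>L P"] by simp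
  also have "\<dots> \<le> norm Q * norm (T - F) * norm P"
    by (rule order_trans[OF norm_cblinfun_compose_le mult_right_mono[OF norm_cblinfun_compose_le]]) simp
  also have "\<dots> \<le> norm (T - F)"
    using mult_right_mono[OF assms(2), of "norm (T - F)"] by (simp add: mult_ac)
  finally show False
    using F(2) by simp
qed

lemma approx_number_weak_star_lsc:
  fixes S :: "'i \<Rightarrow> ('x::complex_normed_vector \<Rightarrow>\<^sub>C\<^sub>L 'z::complex_normed_vector dual)"
  assumes "k \<ge> 1" and S: "weak_star_tendsto S T G" and "c < approx_number k T"
  shows "\<forall>\<^sub>F i in G. c \<le> approx_number k (S i)"
proof (rule ccontr)
  assume contr: "\<not> ?thesis"
  \<comment> \<open>\<open>H\<close> restricts \<open>G\<close> to the bad indices; it is nontrivial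
    because the conclusion is assumed to fail.\<close>
  define H where "H = inf G (principal {i. approx_number k (S i) < c})"
  have "H \<noteq> bot"
    using contr by (auto simp: H_def trivial_limit_def eventually_inf_principal not_less)
  have "\<forall>i. \<exists>F. approx_number k (S i) < c \<longrightarrow> F \<in> finite_rank_less k \<and> norm (S i - F) < c"
    by (auto simp: approx_number_less_iff[OF assms(1)])
  then obtain F where F: "\<And>i. approx_number k (S i) < c \<Longrightarrow>
      F i \<in> finite_rank_less k \<and> norm (S i - F i) < c"
    by metis
  have evH: "\<forall>\<^sub>F i in H. F i \<in> finite_rank_less k \<and> norm (S i - F i) < c"
    by (simp add: H_def eventually_inf_principal F)
  then have "\<forall>\<^sub>F i in H. norm (S i - F i) \<le> c"
    by eventually_elim simp
  then obtain G' R where G': "G' \<le> H" "G' \<noteq> bot"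
      and R: "weak_star_tendsto (\<lambda>i. S i - F i) R G'" "norm R \<le> c"
    using weak_star_cluster_point[OF \<open>H \<noteq> bot\<close>, of "\<lambda>i. S i - F i" c] by blast
  have "G' \<le> G"
    using G'(1) by (simp add: H_def)
  \<comment> \<open>\<open>F i\<close> is \<open>S i\<close> minus \<open>S i - F i\<close>, which
    tend to \<open>T\<close> and \<open>R\<close> along \<open>G'\<close>.\<close>
  have "weak_star_tendsto F (T - R) G'"
    unfolding weak_star_tendsto_iff
  proof safe
    fix x z
    have "((\<lambda>i. S i x z) \<longlongrightarrow> T x z) G'"
      using S \<open>G' \<le> G\<close> by (auto simp: weak_star_tendsto_iff intro: tendsto_mono)
    moreover have "((\<lambda>i. (S i - F i) x z) \<longlongrightarrow> R x z) G'"
      using R(1) by (simp add: weak_star_tendsto_iff)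
    ultimately show "((\<lambda>i. F i x z) \<longlongrightarrow> (T - R) x z) G'"
      using tendsto_diff by (fastforce simp: cblinfun_apply_diff)
  qed
  moreover have "\<forall>\<^sub>F i in G'. F i \<in> finite_rank_less k"
    using filter_leD[OF G'(1) evH] by eventually_elim simp
  ultimately have "T - R \<in> finite_rank_less k"
    using finite_rank_less_weak_star_closed[OF G'(2)] by blast
  \<comment> \<open>\<open>T - R\<close> competes in the infimum for \<open>T\<close> with error
    \<open>R\<close>, of norm at most \<open>c\<close>, against the choice of
    \<open>c\<close>.\<close>
  then have "approx_number k T \<le> norm (T - (T - R))"
    by (rule approx_number_le)
  with R(2) assms(3) show False
    by simp
qed

theorem theorem4:
  fixes T :: "'x::complex_normed_vector \<Rightarrow>\<^sub>C\<^sub>L 'z::complex_normed_vector dual"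
    and P :: "nat \<Rightarrow> ('x \<Rightarrow>\<^sub>C\<^sub>L 'x)"
    and Q :: "nat \<Rightarrow> ('z dual \<Rightarrow>\<^sub>C\<^sub>L 'z dual)"
    and k :: nat
  assumes "\<not> finite_cdim (UNIV :: 'x set)"
    and "\<not> finite_cdim (UNIV :: 'z set)"
    and "\<not> finite_cdim (UNIV :: 'z dual set)"
    and "\<And>n. n \<ge> 1 \<Longrightarrow> norm (P n) * norm (Q n) \<le> 1"
    and "weak_star_tendsto (\<lambda>n. Q n o\<^sub>C\<^sub>L T o\<^sub>C\<^sub>L P n) T sequentially"
    and "k \<ge> 1"
  shows "(\<lambda>n. approx_number k (Q n o\<^sub>C\<^sub>L T o\<^sub>C\<^sub>L P n)) \<longlonglongrightarrow> approx_number k T"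
proof (rule order_tendstoI)
  fix a assume "a < approx_number k T"
  \<comment> \<open>Semicontinuity gives only a non-strict bound, so \<open>c\<close> is interposed
    to make it strict.\<close>
  then obtain c where c: "a < c" "c < approx_number k T"
    using dense by blast
  show "\<forall>\<^sub>F n in sequentially. a < approx_number k (Q n o\<^sub>C\<^sub>L T o\<^sub>C\<^sub>L P n)"
    using approx_number_weak_star_lsc[OF assms(6,5) c(2)] by eventually_elim (use c in simp)
next
  fix a assume a: "approx_number k T < a"
  show "\<forall>\<^sub>F n in sequentially. approx_number k (Q n o\<^sub>C\<^sub>L T o\<^sub>C\<^sub>L P n) < a"
    \<comment> \<open>The norm bound on \<open>P n\<close> and \<open>Q n\<close> starts at
      \<open>n = 1\<close>.\<close>
    using eventually_ge_at_top[of 1]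
    by eventually_elim (meson a approx_number_compose_le assms(4,6) order_le_less_trans)
qed

end
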